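(* Let $\alpha>0$, let $n$ be the smallest integer greater than or equal to $\alpha$, let $m\ge n$ be an integer and let $l\ge1$ be an integer. Then for $t>0$, $$D_{0+}^{\alpha}E_m^{(l)}(t)=\frac{\Gamma(m+1)}{\Gamma(m-n+1)}\sum_{k=0}^{m-n}\frac{k!\binom{m-n}{k}}{\Gamma(n+k-\alpha+1)}\left(\sum_{\substack{s_1+s_2+\cdots+s_l=m-n-k\\ s_1,\dots,s_l\ge0}}\binom{m-n-k}{s_1,s_2,\dots,s_l}\prod_{j=1}^{l}E_{s_j}\right)t^{k-\alpha+n}.$$ In particular, $$D_{0+}^{\alpha}E_m(t)=\frac{\Gamma(m+1)}{\Gamma(m-n+1)}\sum_{k=0}^{m-n}\frac{k!\binom{m-n}{k}E_{m-n-k}}{\Gamma(n+k-\alpha+1)}\,t^{k-\alpha+n}.$$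
   Context: The Caputo fractional derivative of order $\alpha>0$ is $D_{0+}^\alpha y(t)=\frac{1}{\Gamma(n-\alpha)}\int_0^t\frac{y^{(n)}(s)}{(t-s)^{\alpha-n+1}}ds$, where $n$ is the smallest integer greater than or equal to $\alpha$ (for $\alpha=n$ it is the ordinary derivative $y^{(n)}$). The Euler polynomials $E_m(t)$ and the Euler polynomials $E_m^{(l)}(t)$ of order $l$ are defined, for $|z|<\pi$, by $\frac{2}{e^z+1}e^{tz}=\sum_{m=0}^\infty E_m(t)\frac{z^m}{m!}$ and $\left(\frac{2}{e^z+1}\right)^l e^{tz}=\sum_{m=0}^\infty E_m^{(l)}(t)\frac{z^m}{m!}$, so $E_m^{(1)}(t)=E_m(t)$. The Euler numbers here are $E_m:=E_m(0)$. Also $\binom{N}{s_1,\dots,s_l}=\frac{N!}{s_1!\cdots s_l!}$ is the multinomial coefficient. *)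

theory Defs
  imports "HOL-Complex_Analysis.Complex_Analysis"
begin

(* Intended for \<alpha> > 0.  For integer \<alpha> the integral formula degenerates (1 / Gamma 0), and the
   derivative is the ordinary one by convention. *)
definition caputo_deriv :: "real \<Rightarrow> (real \<Rightarrow> real) \<Rightarrow> real \<Rightarrow> real" where
  "caputo_deriv \<alpha> y t =
     (let n = nat \<lceil>\<alpha>\<rceil> in
        if \<alpha> = real n then (deriv ^^ n) y t
        else 1 / Gamma (real n - \<alpha>) *
             integral {0..t} (\<lambda>s. (deriv ^^ n) y s / (t - s) powr (\<alpha> - real n + 1)))"

(* a is the real coefficient sequence of f as an exponential generating function on |z| < r. *)
definition generates_on :: "real \<Rightarrow> (complex \<Rightarrow> complex) \<Rightarrow> (nat \<Rightarrow> real) \<Rightarrow> bool" where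
  "generates_on r f a \<longleftrightarrow>
     (\<forall>z. norm z < r \<longrightarrow> (\<lambda>m. of_real (a m) * (z ^ m / fact m)) sums f z)"

(* The sequences below exist and are unique: see the lemmas generates_on_euler_poly and
   generates_on_euler_poly_order. *)
definition euler_poly :: "nat \<Rightarrow> real \<Rightarrow> real" where
  "euler_poly m t =
     (THE a. generates_on pi (\<lambda>z. 2 / (exp z + 1) * exp (of_real t * z)) a) m"

definition euler_poly_order :: "nat \<Rightarrow> nat \<Rightarrow> real \<Rightarrow> real" where
  "euler_poly_order l m t =
     (THE a. generates_on pi (\<lambda>z. (2 / (exp z + 1)) ^ l * exp (of_real t * z)) a) m"

(* This is the convention E_m = E_m(0), not the secant one E_m = 2^m E_m(1/2). *)
definition euler_number :: "nat \<Rightarrow> real" where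
  "euler_number m = euler_poly m 0"

definition multinomial :: "nat \<Rightarrow> nat list \<Rightarrow> real" where
  "multinomial N s = fact N / (\<Prod>j<length s. fact (s ! j))"


lemma generates_on_unique:
  assumes "r > 0" "generates_on r f a" "generates_on r f b"
  shows "a = b"
proof -
  have *: "f has_fps_expansion Abs_fps (\<lambda>n. complex_of_real (c n) / fact n)"
    if "generates_on r f c" for c
  proof (rule has_fps_expansionI)
    have "eventually (\<lambda>z. z \<in> ball 0 r) (nhds (0::complex))"
      using assms(1) by (intro eventually_nhds_in_open) auto
    thus "eventually (\<lambda>u. (\<lambda>n. fps_nth (Abs_fps (\<lambda>n. complex_of_real (c n) / fact n)) n * u ^ n)
            sums f u) (nhds 0)"
      by eventually_elim (use that in \<open>auto simp: generates_on_def\<close>)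
  qed
  have "Abs_fps (\<lambda>n. complex_of_real (a n) / fact n) = Abs_fps (\<lambda>n. complex_of_real (b n) / fact n)"
    using fps_expansion_unique_complex[OF *[OF assms(2)] *[OF assms(3)]] .
  thus ?thesis
    by (auto simp: fps_eq_iff)
qed

lemma generates_on_exists:
  assumes "r > 0" and holo: "f holomorphic_on ball 0 r"
    and cnj: "\<And>z. norm z < r \<Longrightarrow> f (cnj z) = cnj (f z)"
  shows "\<exists>a. generates_on r f a"
proof -
  define c where "c n = (deriv ^^ n) f 0" for n
  have sums: "(\<lambda>n. c n * (z ^ n / fact n)) sums f z" if "norm z < r" for z
    using holomorphic_power_series[OF holo, of z] that by (simp add: c_def)
  have "(\<lambda>n. of_real (Re (c n)) * (z ^ n / fact n)) sums f z" if z: "norm z < r" for z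
  proof -
    have "(\<lambda>n. cnj (c n * (cnj z ^ n / fact n))) sums cnj (f (cnj z))"
      using sums[of "cnj z"] z by (subst sums_cnj) auto
    hence "(\<lambda>n. cnj (c n) * (z ^ n / fact n)) sums f z"
      using z by (simp add: cnj)
    from sums_add[OF sums[OF z] this]
    have "(\<lambda>n. (c n + cnj (c n)) * (z ^ n / fact n)) sums (2 * f z)"
      by (simp only: ring_distribs mult_2)
    hence "(\<lambda>n. 2 * (of_real (Re (c n)) * (z ^ n / fact n))) sums (2 * f z)"
      by (simp only: complex_add_cnj of_real_mult of_real_numeral mult.assoc)
    thus ?thesis
      by (subst (asm) sums_mult_iff) auto
  qed
  hence "generates_on r f (\<lambda>n. Re (c n))"
    unfolding generates_on_def by blast
  thus ?thesis by blast
qed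

lemma generates_on_euler_poly_order:
  "generates_on pi (\<lambda>z. (2 / (exp z + 1)) ^ l * exp (of_real t * z)) (\<lambda>m. euler_poly_order l m t)"
proof -
  let ?f = "\<lambda>z::complex. (2 / (exp z + 1)) ^ l * exp (of_real t * z)"
  have nz: "exp z + 1 \<noteq> 0" if "norm z < pi" for z :: complex
  proof
    assume "exp z + 1 = 0"
    hence "exp z = exp (\<i> * pi)"
      by (simp add: add_eq_0_iff2)
    then obtain n :: int where n: "z = \<i> * pi + (of_int (2 * n) * pi) * \<i>"
      unfolding exp_eq by auto
    hence "Im z = of_int (2 * n + 1) * pi"
      by (simp add: algebra_simps)
    hence "pi * \<bar>of_int (2 * n + 1)\<bar> \<le> norm z"
      using abs_Im_le_cmod[of z] by (simp add: abs_mult mult.commute)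
    moreover have "(1::int) \<le> \<bar>2 * n + 1\<bar>"
      by presburger
    hence "(1::real) \<le> \<bar>of_int (2 * n + 1)\<bar>"
      by (metis of_int_1_le_iff of_int_abs)
    hence "pi * 1 \<le> pi * \<bar>of_int (2 * n + 1)\<bar>"
      by (intro mult_left_mono) auto
    ultimately show False
      using that by linarith
  qed
  have "\<exists>a. generates_on pi ?f a"
  proof (rule generates_on_exists)
    show "?f holomorphic_on ball 0 pi"
      using nz by (intro holomorphic_intros) auto
  qed (auto simp: exp_cnj)
  then obtain a where a: "generates_on pi ?f a" ..
  have "generates_on pi ?f (THE a. generates_on pi ?f a)"
    by (rule theI[of _ a]) (use a generates_on_unique[OF pi_gt_zero] in blast)+
  thus ?thesis
    by (simp add: euler_poly_order_def)
qed

lemma euler_poly_order_1: "euler_poly_order 1 m t = euler_poly m t"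
  by (simp add: euler_poly_order_def euler_poly_def)

lemma generates_on_euler_poly:
  "generates_on pi (\<lambda>z. 2 / (exp z + 1) * exp (of_real t * z)) (\<lambda>m. euler_poly m t)"
  using generates_on_euler_poly_order[of 1 t] by (simp only: euler_poly_order_1 power_one_right)

end

theory Submission
  imports Defs
begin

text \<open>
  Multiplying exponential generating functions amounts to binomial convolution of the coefficients.
  Splitting off \<open>exp (t z)\<close> shows that the Euler polynomials of order \<open>l\<close> are polynomials in \<open>t\<close>
  with \<open>E\<^sub>m' = m E\<^bsub>m-1\<^esub>\<close>, and splitting off one factor \<open>2 / (exp z + 1)\<close> at a time expresses their
  values at \<open>0\<close> by the multinomial sum. After \<open>n\<close> derivatives the Caputo integral is computed
  termwise by Euler's Beta integral.
\<close>

section \<open>Binomial convolution of exponential generating functions\<close>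

text \<open>Both series converge absolutely inside the disc, so this is the Cauchy product; the
  binomial coefficient comes from 1 / (k! (m-k)!) = binom(m,k) / m!.\<close>

lemma generates_on_mult:
  assumes "generates_on r f a" "generates_on r g b"
  shows "generates_on r (\<lambda>z. f z * g z) (\<lambda>m. \<Sum>k\<le>m. real (m choose k) * a k * b (m - k))"
  unfolding generates_on_def
proof (intro allI impI)
  fix z :: complex
  assume z: "norm z < r"
  \<comment> \<open>\<open>generates_on\<close> gives only convergence; convergence at the real
    point \<open>\<rho>\<close>, farther out than \<open>z\<close>, makes it absolute at
    \<open>z\<close>.\<close>
  obtain \<rho> where \<rho>: "norm z < \<rho>" "\<rho> < r"
    using dense[OF z] by blast
  have summ: "summable (\<lambda>m. norm (of_real (c m) * (z ^ m / fact m)))"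
    if "generates_on r h c" for h c
  proof -
    have "summable (\<lambda>m. complex_of_real (c m) / fact m * of_real \<rho> ^ m)"
      using that[unfolded generates_on_def, rule_format, of "of_real \<rho>"] \<rho> norm_ge_zero[of z]
      by (simp add: sums_iff)
    then have "summable (\<lambda>m. norm (complex_of_real (c m) / fact m * z ^ m))"
      by (rule powser_insidea) (use \<rho> norm_ge_zero[of z] in simp)
    then show ?thesis by (simp add: field_simps)
  qed
  have "(\<lambda>m. \<Sum>k\<le>m. (of_real (a k) * (z ^ k / fact k)) * (of_real (b (m - k)) * (z ^ (m - k) / fact (m - k))))
          sums ((\<Sum>m. of_real (a m) * (z ^ m / fact m)) * (\<Sum>m. of_real (b m) * (z ^ m / fact m)))"
    by (intro Cauchy_product_sums summ[OF assms(1)] summ[OF assms(2)])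
  moreover have "(\<Sum>m. of_real (a m) * (z ^ m / fact m)) = f z"
    "(\<Sum>m. of_real (b m) * (z ^ m / fact m)) = g z"
    using assms z unfolding generates_on_def by (auto intro: sums_unique[symmetric])
  moreover have "(\<Sum>k\<le>m. (of_real (a k) * (z ^ k / fact k)) * (of_real (b (m - k)) * (z ^ (m - k) / fact (m - k))))
      = of_real (\<Sum>k\<le>m. real (m choose k) * a k * b (m - k)) * (z ^ m / fact m)" for m
    unfolding of_real_sum sum_distrib_right
  proof (rule sum.cong[OF refl])
    fix k assume "k \<in> {..m}"
    then have "complex_of_real (real (m choose k)) = fact m / (fact k * fact (m - k))"
      "z ^ m = z ^ k * z ^ (m - k)"
      by (simp_all add: binomial_fact power_add[symmetric])
    then show "(of_real (a k) * (z ^ k / fact k)) * (of_real (b (m - k)) * (z ^ (m - k) / fact (m - k)))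
      = of_real (real (m choose k) * a k * b (m - k)) * (z ^ m / fact m)"
      by simp
  qed
  ultimately show "(\<lambda>m. of_real (\<Sum>k\<le>m. real (m choose k) * a k * b (m - k)) * (z ^ m / fact m))
      sums (f z * g z)"
    by simp
qed

lemma generates_on_exp: "generates_on r (\<lambda>z. exp (of_real t * z)) (\<lambda>m. t ^ m)"
  unfolding generates_on_def
proof (intro allI impI)
  fix z :: complex
  show "(\<lambda>m. of_real (t ^ m) * (z ^ m / fact m)) sums exp (of_real t * z)"
    using exp_converges[of "of_real t * z"]
    by (simp add: scaleR_conv_of_real power_mult_distrib field_simps)
qed

lemma generates_on_const: "generates_on r (\<lambda>z. 1) (\<lambda>m. if m = 0 then 1 else 0)"
  unfolding generates_on_def
proof (intro allI impI)
  fix z :: complex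
  show "(\<lambda>m. of_real (if m = 0 then 1 else 0) * (z ^ m / fact m)) sums 1"
    using sums_If_finite_set[of "{0::nat}" "\<lambda>m. z ^ m / fact m"]
    by (simp add: if_distrib if_distribR cong: if_cong)
qed

section \<open>Values at 0 and the expansion in powers of t\<close>

text \<open>The coefficients of the l-th power of 2 / (exp z + 1). The case \<open>l = 0\<close>,
  with the constant 1, starts the induction on \<open>l\<close>.\<close>

definition euler_number_order :: "nat \<Rightarrow> nat \<Rightarrow> real" where
  "euler_number_order l m = euler_poly_order l m 0"

lemma generates_on_euler_number_order:
  "generates_on pi (\<lambda>z. (2 / (exp z + 1)) ^ l) (euler_number_order l)"
  using generates_on_euler_poly_order[of l 0] by (simp add: euler_number_order_def[abs_def])

lemma euler_poly_order_altdef: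
  "euler_poly_order l m t = (\<Sum>k\<le>m. real (m choose k) * euler_number_order l (m - k) * t ^ k)"
proof -
  \<comment> \<open>With the exponential as first factor, the convolution index \<open>k\<close>
    becomes the exponent of \<open>t\<close>.\<close>
  have "generates_on pi (\<lambda>z. exp (of_real t * z) * (2 / (exp z + 1)) ^ l)
     (\<lambda>m. \<Sum>k\<le>m. real (m choose k) * t ^ k * euler_number_order l (m - k))"
    by (intro generates_on_mult generates_on_exp generates_on_euler_number_order)
  then have "generates_on pi (\<lambda>z. (2 / (exp z + 1)) ^ l * exp (of_real t * z))
     (\<lambda>m. \<Sum>k\<le>m. real (m choose k) * t ^ k * euler_number_order l (m - k))"
    by (simp only: mult.commute)
  from generates_on_unique[OF pi_gt_zero generates_on_euler_poly_order this]
  show ?thesis by (simp add: fun_eq_iff mult_ac)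
qed

lemma euler_number_order_1: "euler_number_order 1 m = euler_number m"
  by (simp only: euler_number_order_def euler_number_def euler_poly_order_1)

lemma euler_number_order_0: "euler_number_order 0 m = (if m = 0 then 1 else 0)"
  using generates_on_unique[OF pi_gt_zero generates_on_euler_number_order[of 0, simplified]
     generates_on_const] by metis

lemma euler_number_order_Suc:
  "euler_number_order (Suc l) m =
     (\<Sum>k\<le>m. real (m choose k) * euler_number k * euler_number_order l (m - k))"
proof -
  \<comment> \<open>The exponent 1 is kept so that both factors are instances of
    \<open>generates_on_euler_number_order\<close>.\<close>
  have "generates_on pi (\<lambda>z. (2 / (exp z + 1)) ^ 1 * (2 / (exp z + 1)) ^ l)
     (\<lambda>m. \<Sum>k\<le>m. real (m choose k) * euler_number_order 1 k * euler_number_order l (m - k))"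
    by (intro generates_on_mult generates_on_euler_number_order)
  then have "generates_on pi (\<lambda>z. (2 / (exp z + 1)) ^ Suc l)
     (\<lambda>m. \<Sum>k\<le>m. real (m choose k) * euler_number k * euler_number_order l (m - k))"
    by (simp only: euler_number_order_1 power_one_right power_Suc)
  from generates_on_unique[OF pi_gt_zero generates_on_euler_number_order this]
  show ?thesis by (simp add: fun_eq_iff)
qed

section \<open>The multinomial sum\<close>

lemma finite_lists_sum: "finite {s :: nat list. length s = l \<and> sum_list s = N}"
  by (rule finite_subset[OF _ finite_lists_length_eq[of "{..N}" l]])
     (auto simp: member_le_sum_list)

text \<open>Induction on \<open>l\<close>: the head of a list is the index taken from the split-off
  factor, and the tail ranges over the compositions of the remainder.\<close>

lemma euler_number_order_multinomial:
  "(\<Sum>s \<in> {s. length s = l \<and> sum_list s = N}.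
      multinomial N s * (\<Prod>j<l. euler_number (s ! j))) = euler_number_order l N"
proof (induction l arbitrary: N)
  case 0
  \<comment> \<open>Only 0 is a sum of no terms, which matches the constant generating function
    1.\<close>
  have "{s :: nat list. length s = 0 \<and> sum_list s = N} = (if N = 0 then {[]} else {})"
    by auto
  then show ?case by (simp add: multinomial_def euler_number_order_0)
next
  case (Suc l)
  let ?S = "\<lambda>l N. {s :: nat list. length s = l \<and> sum_list s = N}"
  have "(\<Sum>s\<in>?S (Suc l) N. multinomial N s * (\<Prod>j<Suc l. euler_number (s ! j))) =
    (\<Sum>(k, s)\<in>(SIGMA k:{..N}. ?S l (N - k)).
       multinomial N (k # s) * (\<Prod>j<Suc l. euler_number ((k # s) ! j)))"
    by (rule sum.reindex_bij_witness[of _ "\<lambda>(k, s). k # s" "\<lambda>s. (hd s, tl s)"])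
       (auto simp: length_Suc_conv)
  also have "\<dots> = (\<Sum>k\<le>N. \<Sum>s\<in>?S l (N - k).
       multinomial N (k # s) * (\<Prod>j<Suc l. euler_number ((k # s) ! j)))"
    by (subst sum.Sigma) (auto simp: finite_lists_sum)
  also have "\<dots> = (\<Sum>k\<le>N. real (N choose k) * euler_number k *
       (\<Sum>s\<in>?S l (N - k). multinomial (N - k) s * (\<Prod>j<l. euler_number (s ! j))))"
  proof (rule sum.cong[OF refl], unfold sum_distrib_left, rule sum.cong[OF refl])
    fix k s assume "k \<in> {..N}" "s \<in> ?S l (N - k)"
    \<comment> \<open>N! / (k! P) = binom(N,k) (N-k)! / P, where P is the product of the factorials
      over the tail.\<close>
    then have "multinomial N (k # s) = real (N choose k) * multinomial (N - k) s"
      by (simp add: multinomial_def binomial_fact prod.lessThan_Suc_shift del: prod.lessThan_Suc)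
    then show "multinomial N (k # s) * (\<Prod>j<Suc l. euler_number ((k # s) ! j)) =
       real (N choose k) * euler_number k * (multinomial (N - k) s * (\<Prod>j<l. euler_number (s ! j)))"
      by (simp add: prod.lessThan_Suc_shift del: prod.lessThan_Suc)
  qed
  also have "\<dots> = euler_number_order (Suc l) N"
    by (simp add: Suc.IH euler_number_order_Suc)
  finally show ?case .
qed

section \<open>Ordinary derivatives\<close>

text \<open>Termwise differentiation and the absorption identity k binom(m,k) = m binom(m-1,k-1).
  For \<open>m = 0\<close> the truncated \<open>m - 1\<close> is harmless, since its factor
  \<open>real m\<close> vanishes.\<close>

lemma euler_poly_order_has_derivative:
  "(euler_poly_order l m has_real_derivative real m * euler_poly_order l (m - 1) t) (at t)"
proof (cases m)
  case 0
  then show ?thesis by (simp add: euler_poly_order_altdef[abs_def])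
next
  case (Suc m')
  have "((\<lambda>t. \<Sum>k\<le>m. real (m choose k) * euler_number_order l (m - k) * t ^ k) has_real_derivative
     (\<Sum>k\<le>m. real (m choose k) * euler_number_order l (m - k) * (real k * t ^ (k - 1)))) (at t)"
    by (auto intro!: derivative_eq_intros sum.cong)
  \<comment> \<open>The term \<open>k = 0\<close> vanishes because of the factor
    \<open>real k\<close>; the others are shifted down by one.\<close>
  also have "(\<Sum>k\<le>m. real (m choose k) * euler_number_order l (m - k) * (real k * t ^ (k - 1))) =
     (\<Sum>k\<le>m'. real (Suc k * (Suc m' choose Suc k)) * euler_number_order l (m' - k) * t ^ k)"
    unfolding Suc sum.atMost_Suc_shift by (simp add: mult_ac del: binomial_Suc_Suc of_nat_Suc mult_Suc mult_Suc_right)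
  also have "\<dots> = real m * euler_poly_order l (m - 1) t"
    unfolding Suc_times_binomial
    by (simp add: Suc euler_poly_order_altdef sum_distrib_left mult_ac del: of_nat_Suc mult_Suc mult_Suc_right)
  finally show ?thesis
    by (simp add: euler_poly_order_altdef[abs_def])
qed

lemma higher_deriv_euler_poly_order:
  assumes "n \<le> m"
  shows "(deriv ^^ n) (euler_poly_order l m) = (\<lambda>t. fact m / fact (m - n) * euler_poly_order l (m - n) t)"
  using assms
proof (induction n)
  case 0
  then show ?case by (simp add: fun_eq_iff)
next
  case (Suc n)
  have "fact (m - n) = real (m - n) * fact (m - Suc n)"
    using Suc.prems by (metis Suc_diff_Suc Suc_le_lessD fact_Suc of_nat_fact of_nat_mult)
  moreover have "real (m - n) \<noteq> 0" using Suc.prems by simp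
  ultimately have "fact m / fact (m - n) * (real (m - n) * euler_poly_order l (m - n - 1) t) =
     fact m / fact (m - Suc n) * euler_poly_order l (m - Suc n) t" for t
    by simp
  then have "((\<lambda>t. fact m / fact (m - n) * euler_poly_order l (m - n) t) has_real_derivative
     fact m / fact (m - Suc n) * euler_poly_order l (m - Suc n) t) (at t)" for t
    using DERIV_cmult[OF euler_poly_order_has_derivative] by metis
  then have "deriv (\<lambda>t. fact m / fact (m - n) * euler_poly_order l (m - n) t) =
      (\<lambda>t. fact m / fact (m - Suc n) * euler_poly_order l (m - Suc n) t)"
    by (intro ext DERIV_imp_deriv)
  then show ?case
    using Suc by simp
qed

section \<open>The Caputo derivative through the Beta integral\<close>

text \<open>The substitution s = t u gives the Beta integral with parameters k + 1 and
  \<open>\<beta>\<close>; \<open>\<beta> > 0\<close> makes the singularity at s = t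
  integrable.\<close>

lemma Riemann_Liouville_integral_power:
  fixes t \<beta> :: real
  assumes "\<beta> > 0" "t > 0"
  shows "((\<lambda>s. s ^ k / (t - s) powr (1 - \<beta>)) has_integral
            fact k * Gamma \<beta> / Gamma (real k + \<beta> + 1) * t powr (real k + \<beta>)) {0..t}"
proof -
  have B: "((\<lambda>u. u powr (real (Suc k) - 1) * (1 - u) powr (\<beta> - 1)) has_integral Beta (real (Suc k)) \<beta>) {0..1}"
    using assms by (intro has_integral_Beta_real) auto
  have "((\<lambda>s. ((s / t) powr (real (Suc k) - 1) * (1 - s / t) powr (\<beta> - 1))) has_integral t * Beta (real (Suc k)) \<beta>) {0..t}"
    using has_integral_affinity'[OF B[unfolded box_real(2)[symmetric]], of "1 / t" 0] assms
    by (simp add: field_simps)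
  \<comment> \<open>This power of \<open>t\<close> combines the t^k needed to restore s^k from
    (s/t)^k with the power \<open>\<beta> - 1\<close> of \<open>t\<close> needed to restore that of
    t - s.\<close>
  from has_integral_mult_right[OF this, of "t powr (real k + \<beta> - 1)"]
  have "((\<lambda>s. t powr (real k + \<beta> - 1) * ((s / t) powr (real (Suc k) - 1) * (1 - s / t) powr (\<beta> - 1)))
      has_integral t powr (real k + \<beta> - 1) * (t * Beta (real (Suc k)) \<beta>)) {0..t}" .
  also have "t powr (real k + \<beta> - 1) * (t * Beta (real (Suc k)) \<beta>) =
      fact k * Gamma \<beta> / Gamma (real k + \<beta> + 1) * t powr (real k + \<beta>)"
    using assms Gamma_fact[of k, where 'a = real]
    by (simp add: Beta_def powr_diff add_ac)
  finally show ?thesis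
  \<comment> \<open>For \<open>k = 0\<close> the integrands differ at \<open>s = 0\<close>, since \<open>0 ^ 0 = 1\<close> but \<open>0 powr 0 = 0\<close>.\<close>
  proof (rule has_integral_spike_finite[where S = "{0, t}", rotated 2])
    fix s assume s: "s \<in> {0..t} - {0, t}"
    have "(1 - s / t) powr (\<beta> - 1) = ((t - s) / t) powr (\<beta> - 1)"
      using assms by (simp add: field_simps)
    moreover have "(t - s) powr (\<beta> - 1) = 1 / (t - s) powr (1 - \<beta>)"
      using powr_minus_divide[of "t - s" "1 - \<beta>"] by simp
    moreover have "t powr (real k + \<beta> - 1) = t ^ k * t powr (\<beta> - 1)"
      using assms powr_add[of t "real k" "\<beta> - 1"] by (simp add: powr_realpow add_diff_eq)
    ultimately show "s ^ k / (t - s) powr (1 - \<beta>) =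
       t powr (real k + \<beta> - 1) * ((s / t) powr (real (Suc k) - 1) * (1 - s / t) powr (\<beta> - 1))"
      using s assms by (simp add: powr_divide powr_realpow power_divide)
  qed simp
qed

lemma caputo_deriv_euler_poly_order:
  assumes "\<alpha> > 0" and n: "n = nat \<lceil>\<alpha>\<rceil>" and "n \<le> m" and "t > 0"
  shows "caputo_deriv \<alpha> (euler_poly_order l m) t =
           fact m / fact (m - n) *
           (\<Sum>k = 0..m - n. fact k * real ((m - n) choose k) / Gamma (real n + real k - \<alpha> + 1) *
              euler_number_order l (m - n - k) * t powr (real k - \<alpha> + real n))"
proof (cases "\<alpha> = real n")
  \<comment> \<open>Here the Gamma value in the sum is k!, which cancels \<open>fact k\<close>, and
    the powers of \<open>t\<close> are t^k: the formula is the expansion of the n-th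
    derivative.\<close>
  case True
  then show ?thesis
    using assms Gamma_fact[where 'a = real]
    by (simp add: caputo_deriv_def Let_def higher_deriv_euler_poly_order euler_poly_order_altdef
         powr_realpow atMost_atLeast0 add.commute[of _ 1])
next
  case False
  \<comment> \<open>The order of the fractional integral applied to the n-th derivative; the kernel
    exponent is \<open>1 - \<beta>\<close>.\<close>
  define \<beta> where "\<beta> = real n - \<alpha>"
  have "\<alpha> \<le> real n" unfolding n by (rule of_nat_ceiling)
  then have \<beta>: "\<beta> > 0" using False by (simp add: \<beta>_def)
  then have G: "Gamma \<beta> \<noteq> 0" using Gamma_real_pos[of \<beta>] by linarith
  \<comment> \<open>The coefficient of s^k in the n-th derivative.\<close>
  let ?c = "\<lambda>k. fact m / fact (m - n) * (real ((m - n) choose k) * euler_number_order l (m - n - k))"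
  have "((\<lambda>s. \<Sum>k\<le>m - n. ?c k * (s ^ k / (t - s) powr (1 - \<beta>))) has_integral
     (\<Sum>k\<le>m - n. ?c k * (fact k * Gamma \<beta> / Gamma (real k + \<beta> + 1) * t powr (real k + \<beta>)))) {0..t}"
    using \<beta> \<open>t > 0\<close> by (intro has_integral_sum has_integral_mult_right Riemann_Liouville_integral_power) auto
  also have "(\<lambda>s. \<Sum>k\<le>m - n. ?c k * (s ^ k / (t - s) powr (1 - \<beta>))) =
     (\<lambda>s. (deriv ^^ n) (euler_poly_order l m) s / (t - s) powr (\<alpha> - real n + 1))"
    using \<open>n \<le> m\<close>
    by (simp add: higher_deriv_euler_poly_order euler_poly_order_altdef \<beta>_def sum_distrib_left
          sum_divide_distrib mult_ac algebra_simps)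
  finally have I: "integral {0..t} (\<lambda>s. (deriv ^^ n) (euler_poly_order l m) s / (t - s) powr (\<alpha> - real n + 1)) =
     (\<Sum>k\<le>m - n. ?c k * (fact k * Gamma \<beta> / Gamma (real k + \<beta> + 1) * t powr (real k + \<beta>)))"
    by (rule integral_unique)
  have "caputo_deriv \<alpha> (euler_poly_order l m) t = 1 / Gamma \<beta> *
     (\<Sum>k\<le>m - n. ?c k * (fact k * Gamma \<beta> / Gamma (real k + \<beta> + 1) * t powr (real k + \<beta>)))"
    using False by (simp add: caputo_deriv_def Let_def n[symmetric] I \<beta>_def)
  \<comment> \<open>The factor \<open>Gamma \<beta>\<close> from each Beta integral cancels the
    prefactor of the Caputo derivative.\<close>
  also have "\<dots> = fact m / fact (m - n) *
     (\<Sum>k = 0..m - n. fact k * real ((m - n) choose k) / Gamma (real n + real k - \<alpha> + 1) *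
              euler_number_order l (m - n - k) * t powr (real k - \<alpha> + real n))"
    unfolding sum_distrib_left atMost_atLeast0
  proof (rule sum.cong[OF refl])
    fix k
    have eqs: "real n + real k - \<alpha> + 1 = real k + \<beta> + 1" "real k - \<alpha> + real n = real k + \<beta>"
      by (simp_all add: \<beta>_def)
    show "1 / Gamma \<beta> * (?c k * (fact k * Gamma \<beta> / Gamma (real k + \<beta> + 1) * t powr (real k + \<beta>))) =
       fact m / fact (m - n) * (fact k * real ((m - n) choose k) / Gamma (real n + real k - \<alpha> + 1) *
              euler_number_order l (m - n - k) * t powr (real k - \<alpha> + real n))"
      unfolding eqs using G by simp
  qed
  finally show ?thesis .
qed

theorem theorem7:
  fixes \<alpha> t :: real and n m l :: nat
  assumes "\<alpha> > 0" and "n = nat \<lceil>\<alpha>\<rceil>" and "m \<ge> n" and "l \<ge> 1" and "t > 0"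
  shows "caputo_deriv \<alpha> (euler_poly_order l m) t =
           Gamma (real m + 1) / Gamma (real m - real n + 1) *
           (\<Sum>k = 0..m - n.
              fact k * real ((m - n) choose k) / Gamma (real n + real k - \<alpha> + 1) *
              (\<Sum>s \<in> {s :: nat list. length s = l \<and> sum_list s = m - n - k}.
                 multinomial (m - n - k) s * (\<Prod>j<l. euler_number (s ! j))) *
              t powr (real k - \<alpha> + real n)) \<and>
         caputo_deriv \<alpha> (euler_poly m) t =
           Gamma (real m + 1) / Gamma (real m - real n + 1) *
           (\<Sum>k = 0..m - n.
              fact k * real ((m - n) choose k) * euler_number (m - n - k) /
              Gamma (real n + real k - \<alpha> + 1) *
              t powr (real k - \<alpha> + real n))"
proof -
  have "Gamma (real m + 1) = fact m" "Gamma (real m - real n + 1) = fact (m - n)"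
    using Gamma_fact[of m, where 'a = real] Gamma_fact[of "m - n", where 'a = real] assms
    by (simp_all add: of_nat_diff add.commute)
  \<comment> \<open>The second claim is the case of order 1, where the values at 0 are the Euler
    numbers themselves.\<close>
  moreover have "euler_poly m = euler_poly_order 1 m"
    by (simp only: fun_eq_iff euler_poly_order_1 simp_thms)
  ultimately show ?thesis
    by (simp only: euler_number_order_multinomial euler_number_order_1
         caputo_deriv_euler_poly_order[OF assms(1,2,3,5)] times_divide_eq_left simp_thms)
qed

end
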